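(* Let $\mathcal R=\{\overline{\mathrm{Ref}},=_1,=_2,\mathrm{Cut}\}$. If $\Gamma$ is a multiset of identities, $E$ is an equality, and $E,\Gamma\Rightarrow E'$ is derivable in $\mathcal R$, where $E'$ coincides with $a=f(f(a))$ or with $f(f(a))=a$, then also $E$ has one of these two forms. Hence $a=f(a)\Rightarrow a=f(f(a))$ is not derivable in $\mathcal R$.
   Context: Formulas are those of a first-order language with equality, with bound variables syntactically distinct from free ones; $f$ is a unary function symbol of the language and $a$ is a free variable or a constant. Equalities $t=t'$ are atomic; $\bot$ is not counted as atomic. An identity is an equality of the form $t=t$. A sequent $\Gamma\Rightarrow\Delta$ consists of finite multisets $\Gamma,\Delta$ of formulas; comma is multiset union. $P[x/r]$ is the result of replacing all occurrences of $x$ in the atomic formula $P$ by the term $r$. A set $\mathcal R$ of rules is identified with the calculus whose initial sequents are $P,\Gamma\Rightarrow\Delta,P$ ($P$ atomic) together with $\bot,\Gamma\Rightarrow\Delta$ in the intuitionistic and classical case, respectively $\bot,\Gamma\Rightarrow\Delta,\bot$ in the minimal case, and whose rules are those of $\mathcal R$ (no logical rules); statements about $\mathcal R$ are meant for each of these cases. Rules ($P$ atomic, possibly an equality). $\overline{\mathrm{Ref}}$: axioms $\Gamma\Rightarrow\Delta,t=t$. $=_1$: from $\Gamma\Rightarrow\Delta,P[x/r]$ infer $r=s,\Gamma\Rightarrow\Delta,P[x/s]$. $=_2$: from $\Gamma\Rightarrow\Delta,P[x/r]$ infer $s=r,\Gamma\Rightarrow\Delta,P[x/s]$. $\mathrm{Cut}$: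 from $\Gamma\Rightarrow\Delta,A$ and $A,\Lambda\Rightarrow\Theta$ infer $\Gamma,\Lambda\Rightarrow\Delta,\Theta$, for arbitrary formulas $A$. *)

theory Defs
  imports Main "HOL-Library.Multiset"
begin

record ('f, 'p) language =
  fun_arity :: "'f \<Rightarrow> nat"
  rel_arity :: "'p \<Rightarrow> nat"

text \<open>
  Free variables \<open>Fv\<close> and bound variables \<open>Bv\<close> are syntactically distinct.
  The datatypes contain raw expressions; terms and formulas of a language are those that
  respect the arities and in which every \<open>Bv\<close> lies in the scope of a quantifier
  binding it. Formulas that differ only in the names of bound variables are not identified.
\<close>

datatype 'f tm = Fv nat | Bv nat | App 'f "'f tm list"

datatype ('f, 'p) fm =
    Eq "'f tm" "'f tm"
  | Rel 'p "'f tm list"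
  | Bot
  | Conj "('f, 'p) fm" "('f, 'p) fm"
  | Disj "('f, 'p) fm" "('f, 'p) fm"
  | Impl "('f, 'p) fm" "('f, 'p) fm"
  | All nat "('f, 'p) fm"
  | Ex nat "('f, 'p) fm"

primrec wf_tm :: "('f, 'p) language \<Rightarrow> nat set \<Rightarrow> 'f tm \<Rightarrow> bool" where
  "wf_tm L V (Fv i) \<longleftrightarrow> True"
| "wf_tm L V (Bv x) \<longleftrightarrow> x \<in> V"
| "wf_tm L V (App g ts) \<longleftrightarrow> length ts = fun_arity L g \<and> list_all (wf_tm L V) ts"

primrec wf_fm :: "('f, 'p) language \<Rightarrow> nat set \<Rightarrow> ('f, 'p) fm \<Rightarrow> bool" where
  "wf_fm L V (Eq t u) \<longleftrightarrow> wf_tm L V t \<and> wf_tm L V u"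
| "wf_fm L V (Rel p ts) \<longleftrightarrow> length ts = rel_arity L p \<and> list_all (wf_tm L V) ts"
| "wf_fm L V Bot \<longleftrightarrow> True"
| "wf_fm L V (Conj A B) \<longleftrightarrow> wf_fm L V A \<and> wf_fm L V B"
| "wf_fm L V (Disj A B) \<longleftrightarrow> wf_fm L V A \<and> wf_fm L V B"
| "wf_fm L V (Impl A B) \<longleftrightarrow> wf_fm L V A \<and> wf_fm L V B"
| "wf_fm L V (All x A) \<longleftrightarrow> wf_fm L (insert x V) A"
| "wf_fm L V (Ex x A) \<longleftrightarrow> wf_fm L (insert x V) A"

definition is_formula :: "('f, 'p) language \<Rightarrow> ('f, 'p) fm \<Rightarrow> bool" where
  "is_formula L A \<longleftrightarrow> wf_fm L {} A"

definition is_equality :: "('f, 'p) fm \<Rightarrow> bool" where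
  "is_equality A \<longleftrightarrow> (\<exists>t u. A = Eq t u)"

definition is_identity :: "('f, 'p) fm \<Rightarrow> bool" where
  "is_identity A \<longleftrightarrow> (\<exists>t. A = Eq t t)"

definition is_atomic :: "('f, 'p) fm \<Rightarrow> bool" where
  "is_atomic A \<longleftrightarrow> (\<exists>t u. A = Eq t u) \<or> (\<exists>p ts. A = Rel p ts)"

primrec subst_tm :: "nat \<Rightarrow> 'f tm \<Rightarrow> 'f tm \<Rightarrow> 'f tm" where
  "subst_tm x r (Fv i) = (if i = x then r else Fv i)"
| "subst_tm x r (Bv y) = Bv y"
| "subst_tm x r (App g ts) = App g (map (subst_tm x r) ts)"

text \<open>Capture is impossible, as \<open>x\<close> is free and terms contain no bound variables.\<close>

primrec subst_fm :: "nat \<Rightarrow> 'f tm \<Rightarrow> ('f, 'p) fm \<Rightarrow> ('f, 'p) fm" where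
  "subst_fm x r (Eq t u) = Eq (subst_tm x r t) (subst_tm x r u)"
| "subst_fm x r (Rel p ts) = Rel p (map (subst_tm x r) ts)"
| "subst_fm x r Bot = Bot"
| "subst_fm x r (Conj A B) = Conj (subst_fm x r A) (subst_fm x r B)"
| "subst_fm x r (Disj A B) = Disj (subst_fm x r A) (subst_fm x r B)"
| "subst_fm x r (Impl A B) = Impl (subst_fm x r A) (subst_fm x r B)"
| "subst_fm x r (All y A) = All y (subst_fm x r A)"
| "subst_fm x r (Ex y A) = Ex y (subst_fm x r A)"

datatype ('f, 'p) sequent =
  Sequent "('f, 'p) fm multiset" "('f, 'p) fm multiset"  (infix "\<turnstile>" 50)

primrec is_sequent :: "('f, 'p) language \<Rightarrow> ('f, 'p) sequent \<Rightarrow> bool" where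
  "is_sequent L (\<Gamma> \<turnstile> \<Delta>) \<longleftrightarrow> (\<forall>A \<in># \<Gamma> + \<Delta>. is_formula L A)"

datatype variant = Minimal | Intuitionistic | Classical

inductive initial :: "variant \<Rightarrow> ('f, 'p) sequent \<Rightarrow> bool" for v where
  atom: "is_atomic P \<Longrightarrow> initial v (add_mset P \<Gamma> \<turnstile> add_mset P \<Delta>)"
| bot: "v \<in> {Intuitionistic, Classical} \<Longrightarrow> initial v (add_mset Bot \<Gamma> \<turnstile> \<Delta>)"
| bot_min: "v = Minimal \<Longrightarrow> initial v (add_mset Bot \<Gamma> \<turnstile> add_mset Bot \<Delta>)"

text \<open>
  A rule is the set of its instances (premises, conclusion). The instances are stated for raw
  expressions; \<open>derivable\<close> below only admits those whose sequents belong to the language,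
  which forces all terms and formulas occurring in an instance to belong to it as well.
\<close>

type_synonym ('f, 'p) rule = "(('f, 'p) sequent list \<times> ('f, 'p) sequent) set"

definition Ref_bar :: "('f, 'p) rule" where
  "Ref_bar = {([], \<Gamma> \<turnstile> add_mset (Eq t t) \<Delta>) | \<Gamma> \<Delta> t. True}"

definition Eq1 :: "('f, 'p) rule" where
  "Eq1 = {([\<Gamma> \<turnstile> add_mset (subst_fm x r P) \<Delta>],
           add_mset (Eq r s) \<Gamma> \<turnstile> add_mset (subst_fm x s P) \<Delta>) | \<Gamma> \<Delta> P x r s. is_atomic P}"

definition Eq2 :: "('f, 'p) rule" where
  "Eq2 = {([\<Gamma> \<turnstile> add_mset (subst_fm x r P) \<Delta>],
           add_mset (Eq s r) \<Gamma> \<turnstile> add_mset (subst_fm x s P) \<Delta>) | \<Gamma> \<Delta> P x r s. is_atomic P}"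

definition Cut :: "('f, 'p) rule" where
  "Cut = {([\<Gamma> \<turnstile> add_mset A \<Delta>, add_mset A \<Lambda> \<turnstile> \<Theta>], \<Gamma> + \<Lambda> \<turnstile> \<Delta> + \<Theta>) | \<Gamma> \<Delta> \<Lambda> \<Theta> A. True}"

inductive derivable ::
  "('f, 'p) language \<Rightarrow> variant \<Rightarrow> ('f, 'p) rule set \<Rightarrow> ('f, 'p) sequent \<Rightarrow> bool"
  for L v \<R> where
  init: "is_sequent L S \<Longrightarrow> initial v S \<Longrightarrow> derivable L v \<R> S"
| step: "R \<in> \<R> \<Longrightarrow> (Ss, S) \<in> R \<Longrightarrow> is_sequent L S \<Longrightarrow>
    (\<And>S'. S' \<in> set Ss \<Longrightarrow> derivable L v \<R> S') \<Longrightarrow> derivable L v \<R> S"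

end

theory Submission
  imports Defs
begin

text \<open>
  Contexts are multisets and there is no contraction, so a derivation consumes each antecedent
  formula at most once. This is made quantitative by giving every formula a weight and showing that
  in a derivable sequent without falsum in the antecedent, the total weight of the antecedent is at
  least the weight of some succedent formula. Identities cost \<open>0\<close>, the two targets
  \<open>a = f(f(a))\<close> and \<open>f(f(a)) = a\<close> cost \<open>2\<close>, everything else
  costs \<open>1\<close>. Cut preserves the inequality because weights of antecedents add up. For
  the equality rules, a replacement of different terms in a formula that is not an identity has
  weight \<open>2\<close> at its disposal, which pays for anything; the essential point is that a
  replacement in an identity produces a target only if the equality used for the replacement is
  itself a target (\<open>replace_in_identity_gives_target\<close>): replacing reaches
  \<open>f(f(a))\<close> on one side and \<open>a\<close> on the other, from a common term, only by
  exchanging \<open>a\<close> and \<open>f(f(a))\<close>.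

  Identities weigh nothing, so an antecedent of one equality \<open>E\<close> and identities that
  yields a target has \<open>E\<close> of weight \<open>2\<close>. In particular one copy of
  \<open>a = f(a)\<close>, of weight \<open>1\<close>, is too little, although two copies suffice to
  derive \<open>a = f(f(a))\<close>.
\<close>

definition is_target :: "'f \<Rightarrow> 'f tm \<Rightarrow> ('f, 'p) fm \<Rightarrow> bool" where
  "is_target f a A \<longleftrightarrow> A = Eq a (App f [App f [a]]) \<or> A = Eq (App f [App f [a]]) a"

definition weight :: "'f \<Rightarrow> 'f tm \<Rightarrow> ('f, 'p) fm \<Rightarrow> nat" where
  "weight f a A = (if is_identity A then 0 else if is_target f a A then 2 else 1)"

text \<open>
  Except in the minimal case, falsum in the antecedent allows any succedent, even an empty one, so
  it is a way out of the weight inequality. It must then not count as an affordable succedent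
  formula, or a cut on it would break the invariant.
\<close>

primrec affordable :: "'f \<Rightarrow> 'f tm \<Rightarrow> ('f, 'p) sequent \<Rightarrow> bool" where
  "affordable f a (\<Gamma> \<turnstile> \<Delta>) \<longleftrightarrow>
     Bot \<in># \<Gamma> \<or> (\<exists>A \<in># \<Delta>. A \<noteq> Bot \<and> weight f a A \<le> (\<Sum>B \<in># \<Gamma>. weight f a B))"

lemma App1_neq: "t \<noteq> App g [t]" "App g [t] \<noteq> t"
  "t \<noteq> App g [App g [t]]" "App g [App g [t]] \<noteq> t"
proof -
  have "size t < size (App g [t])" and "size t < size (App g [App g [t]])"
    by simp_all
  then show "t \<noteq> App g [t]" "App g [t] \<noteq> t"
    "t \<noteq> App g [App g [t]]" "App g [App g [t]] \<noteq> t"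
    by (metis less_irrefl)+
qed

lemma subst_tm_eq_App1_iff:
  "subst_tm x s v = App g [t] \<longleftrightarrow>
     v = Fv x \<and> s = App g [t] \<or> (\<exists>w. v = App g [w] \<and> subst_tm x s w = t)"
  by (cases v) auto

lemma subst_tm_eq_simple_iff:
  assumes "(\<exists>i. a = Fv i) \<or> (\<exists>c. a = App c [])"
  shows "subst_tm x s u = a \<longleftrightarrow> u = Fv x \<and> s = a \<or> u = a \<and> u \<noteq> Fv x"
  using assms by (cases u) auto

text \<open>
  The term \<open>a\<close> has no proper subterms, so \<open>x\<close> can occur in
  \<open>u\<close> and \<open>v\<close> in only a few ways. In the surviving ones, one of
  \<open>u\<close> and \<open>v\<close> is \<open>x\<close> itself and the other one does not
  contain \<open>x\<close>. All others would make some term equal to a proper subterm of itself, or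
  \<open>a\<close> compound.
\<close>

lemma replacement_separating_simple_from_twice_App:
  assumes a: "(\<exists>i. a = Fv i) \<or> (\<exists>c. a = App c [])"
    and "subst_tm x r u = subst_tm x r v"
    and "subst_tm x s u = a" and "subst_tm x s v = App f [App f [a]]"
  shows "r = a \<and> s = App f [App f [a]] \<or> r = App f [App f [a]] \<and> s = a"
proof -
  have u: "u = Fv x \<and> s = a \<or> u = a \<and> u \<noteq> Fv x"
    using assms(3) subst_tm_eq_simple_iff[OF a] by blast
  have const: "subst_tm x r a = a" if "a \<noteq> Fv x"
    using subst_tm_eq_simple_iff[OF a] that by blast
  have a_neq: "a \<noteq> App f [t]" for t
    using a by auto
  consider "v = Fv x" "s = App f [App f [a]]"
    | "v = App f [Fv x]" "s = App f [a]"
    | "v = App f [App f [Fv x]]" "s = a"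
    | "v = App f [App f [a]]" "a \<noteq> Fv x"
    using assms(4) unfolding subst_tm_eq_App1_iff subst_tm_eq_simple_iff[OF a] by blast
  then show ?thesis
    using u assms(2) const a_neq by cases (auto simp: App1_neq)
qed

lemma replace_in_identity_gives_target:
  fixes P :: "('f, 'p) fm"
  assumes a: "(\<exists>i. a = Fv i) \<or> (\<exists>c. a = App c [])"
    and P: "is_identity (subst_fm x r P)" and Q: "is_target f a (subst_fm x s P)"
  shows "is_target f a (Eq r s :: ('f, 'p) fm)"
proof -
  obtain u v where uv: "P = Eq u v" and eq: "subst_tm x r u = subst_tm x r v"
    using P unfolding is_identity_def by (cases P) auto
  from Q show ?thesis
    using replacement_separating_simple_from_twice_App[OF a eq]
      replacement_separating_simple_from_twice_App[OF a eq[symmetric]]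
    unfolding uv is_target_def by auto
qed

lemma weight_Eq_commute:
  "weight f a (Eq r s :: ('f, 'p) fm) = weight f a (Eq s r :: ('f, 'p) fm)"
  unfolding weight_def is_identity_def is_target_def by auto

lemma weight_replace:
  fixes P :: "('f, 'p) fm"
  assumes a: "(\<exists>i. a = Fv i) \<or> (\<exists>c. a = App c [])" and P: "is_atomic P"
  shows "weight f a (subst_fm x s P) \<le> weight f a (Eq r s :: ('f, 'p) fm) + weight f a (subst_fm x r P)"
proof (cases "r = s")
  case False
  \<comment> \<open>The equality costs at least \<open>1\<close>, so only a target obtained from an identity is in doubt.\<close>
  then have rs: "\<not> is_identity (Eq r s :: ('f, 'p) fm)"
    by (simp add: is_identity_def)
  show ?thesis
    using rs replace_in_identity_gives_target[OF a, of x r P f s]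
    by (auto simp: weight_def)
qed simp

lemma affordable_replace:
  assumes a: "(\<exists>i. a = Fv i) \<or> (\<exists>c. a = App c [])" and P: "is_atomic P"
    and prem: "affordable f a (\<Gamma> \<turnstile> add_mset (subst_fm x r P) \<Delta>)"
  shows "affordable f a (add_mset (Eq r s) \<Gamma> \<turnstile> add_mset (subst_fm x s P) \<Delta>)"
proof -
  have "subst_fm x s P \<noteq> Bot"
    using P by (auto simp: is_atomic_def)
  with prem weight_replace[OF a P, of f x s r] show ?thesis
    by (fastforce intro: trans_le_add2)
qed

lemma affordable_swap_Eq:
  "affordable f a (add_mset (Eq r s) \<Gamma> \<turnstile> \<Delta>) \<Longrightarrow> affordable f a (add_mset (Eq s r) \<Gamma> \<turnstile> \<Delta>)"
  by (simp add: weight_Eq_commute[of f a r s])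

lemma affordable_cut:
  assumes "affordable f a (\<Gamma> \<turnstile> add_mset A \<Delta>)" and "affordable f a (add_mset A \<Lambda> \<turnstile> \<Theta>)"
  shows "affordable f a (\<Gamma> + \<Lambda> \<turnstile> \<Delta> + \<Theta>)"
  using assms by (fastforce intro: trans_le_add1 trans_le_add2)

lemma derivable_affordable:
  assumes a: "(\<exists>i. a = Fv i) \<or> (\<exists>c. a = App c [])"
    and "derivable L v {Ref_bar, Eq1, Eq2, Cut} S"
  shows "affordable f a S"
  using assms(2)
proof (induction rule: derivable.induct)
  case (init S)
  from init(2) show ?case
    by cases (auto simp: is_atomic_def)
next
  case (step R Ss S)
  then consider "(Ss, S) \<in> Ref_bar" | "(Ss, S) \<in> Eq1" | "(Ss, S) \<in> Eq2" | "(Ss, S) \<in> Cut"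
    by blast
  then show ?case
  proof cases
    case 1
    then show ?thesis
      by (auto simp: Ref_bar_def weight_def is_identity_def)
  next
    case 2
    then show ?thesis
      using step.IH affordable_replace[OF a] by (fastforce simp: Eq1_def simp del: affordable.simps)
  next
    case 3
    then show ?thesis
      using step.IH affordable_swap_Eq[OF affordable_replace[OF a]]
      by (fastforce simp: Eq2_def simp del: affordable.simps)
  next
    case 4
    then show ?thesis
      using step.IH affordable_cut by (fastforce simp: Cut_def simp del: affordable.simps)
  qed
qed

lemma target_from_equality_and_identities:
  assumes a: "(\<exists>i. a = Fv i) \<or> (\<exists>c. a = App c [])"
    and \<Gamma>: "\<forall>A \<in># \<Gamma>. is_identity A" and E: "is_equality E" and E': "is_target f a E'"
    and der: "derivable L v {Ref_bar, Eq1, Eq2, Cut} (add_mset E \<Gamma> \<turnstile> {#E'#})"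
  shows "is_target f a E"
proof -
  have "Bot \<notin># add_mset E \<Gamma>"
    using \<Gamma> E by (auto simp: is_equality_def is_identity_def)
  then have "weight f a E' \<le> weight f a E + (\<Sum>B \<in># \<Gamma>. weight f a B)"
    using derivable_affordable[OF a der, of f] by auto
  also have "(\<Sum>B \<in># \<Gamma>. weight f a B) = 0"
    using \<Gamma> by (simp add: weight_def)
  finally have "weight f a E' \<le> weight f a E"
    by simp
  moreover have "weight f a E' = 2"
    using E' by (auto simp: weight_def is_identity_def is_target_def App1_neq)
  ultimately show ?thesis
    by (auto simp: weight_def split: if_splits)
qed

theorem proposition4:
  fixes L :: "('f, 'p) language" and v :: variant and f :: 'f and a :: "'f tm"
  assumes f: "fun_arity L f = 1"
    and a: "(\<exists>i. a = Fv i) \<or> (\<exists>c. fun_arity L c = 0 \<and> a = App c [])"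
  shows "(\<forall>(\<Gamma> :: ('f, 'p) fm multiset) E E'.
            (\<forall>A \<in># \<Gamma>. is_identity A) \<and> is_equality E \<and>
            (E' = Eq a (App f [App f [a]]) \<or> E' = Eq (App f [App f [a]]) a) \<and>
            derivable L v {Ref_bar, Eq1, Eq2, Cut} (add_mset E \<Gamma> \<turnstile> {#E'#}) \<longrightarrow>
            E = Eq a (App f [App f [a]]) \<or> E = Eq (App f [App f [a]]) a) \<and>
         \<not> derivable L v {Ref_bar, Eq1, Eq2, Cut}
             ({#Eq a (App f [a])#} \<turnstile> {#Eq a (App f [App f [a]])#})"
proof -
  have a': "(\<exists>i. a = Fv i) \<or> (\<exists>c. a = App c [])"
    using a by blast
  have "\<not> derivable L v {Ref_bar, Eq1, Eq2, Cut}
          ({#Eq a (App f [a]) :: ('f, 'p) fm#} \<turnstile> {#Eq a (App f [App f [a]])#})"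
    using target_from_equality_and_identities[OF a', of "{#}" "Eq a (App f [a])" f]
    by (auto simp: is_equality_def is_target_def App1_neq)
  then show ?thesis
    using target_from_equality_and_identities[OF a', of _ _ f]
    unfolding is_target_def by blast
qed

end
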